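(* Let $X$ be a $\delta$-hyperbolic geodesic metric space for some $\delta > 0$. Suppose that there exist $n \ge 0$ and $c > 0$ such that for all $s \in (0,\delta]$, $X$ has a $cs$-bounded covering with $s$-multiplicity at most $n+1$. Then $\dim_{\rm N} X < \infty$.
   Context: A family $(B_i)_{i\in I}$ of subsets of a metric space $X=(X,d)$ is called $D$-bounded ($D \ge 0$) if $\operatorname{diam} B_i := \sup\{d(x,x') : x,x'\in B_i\} \le D$ for all $i$. For $s>0$, the $s$-multiplicity of the family is the infimum of all integers $n \ge 0$ such that every subset of $X$ with diameter $\le s$ meets at most $n$ members of the family. The Nagata dimension $\dim_{\rm N} X$ of a metric space $X$ is the infimum of all integers $n$ with the following property: there exists a constant $c>0$ such that for all $s>0$, $X$ has a $cs$-bounded covering with $s$-multiplicity at most $n+1$ (the value is $\infty$ if there is no such $n$). For $\delta \ge 0$, a geodesic metric space $X$ is called $\delta$-hyperbolic if $d(y,y') \le \delta$ whenever $x,x',z \in X$, $y$ and $y'$ lie on geodesics from $z$ to $x$ and $x'$, respectively, and $d(y,z) = d(y',z) \le \frac12 (d(x,z) + d(x',z) - d(x,x'))$. *)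

theory Defs
  imports "HOL-Analysis.Analysis"
begin

context Metric_space
begin

(* The supremum is taken in [0,\<infinity>]: empty sets have diameter 0, unbounded sets
   diameter \<infinity>. (The library's real-valued diameter is unspecified on unbounded sets.) *)
definition ext_diam :: "'a set \<Rightarrow> ennreal" where
  "ext_diam B = (SUP x\<in>B. SUP x'\<in>B. ennreal (d x x'))"

definition bounded_family :: "real \<Rightarrow> 'i set \<Rightarrow> ('i \<Rightarrow> 'a set) \<Rightarrow> bool" where
  "bounded_family D I B \<longleftrightarrow> (\<forall>i\<in>I. ext_diam (B i) \<le> ennreal D)"

(* Members are counted by index; the infimum of the empty set is \<infinity>. *)
definition multiplicity_at :: "real \<Rightarrow> 'i set \<Rightarrow> ('i \<Rightarrow> 'a set) \<Rightarrow> enat" where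
  "multiplicity_at s I B = Inf {enat n | n. \<forall>A\<subseteq>M. ext_diam A \<le> ennreal s \<longrightarrow>
      finite {i\<in>I. A \<inter> B i \<noteq> {}} \<and> card {i\<in>I. A \<inter> B i \<noteq> {}} \<le> n}"

definition covering :: "'i set \<Rightarrow> ('i \<Rightarrow> 'a set) \<Rightarrow> bool" where
  "covering I B \<longleftrightarrow> (\<forall>i\<in>I. B i \<subseteq> M) \<and> (\<Union>i\<in>I. B i) = M"

(* HOL cannot quantify existentially over the type of indices. Taking subsets of the space
   as indices loses nothing, see has_bounded_coveringI below. *)
definition has_bounded_covering :: "real \<Rightarrow> real \<Rightarrow> int \<Rightarrow> bool" where
  "has_bounded_covering D s k \<longleftrightarrow> (\<exists>(I :: 'a set set) (B :: 'a set \<Rightarrow> 'a set).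
      covering I B \<and> bounded_family D I B \<and>
      ereal_of_enat (multiplicity_at s I B) \<le> ereal (of_int k))"

(* As n ranges over the integers, the empty space has dimension -1. *)
definition nagata_dim :: ereal where
  "nagata_dim = Inf {ereal (of_int n) | n :: int.
      \<exists>c>0. \<forall>s>0. has_bounded_covering (c * s) s (n + 1)}"

(* g is a geodesic from x to y, parametrized by arc length on [0, d x y]. *)
definition geodesic_from_to :: "(real \<Rightarrow> 'a) \<Rightarrow> 'a \<Rightarrow> 'a \<Rightarrow> bool" where
  "geodesic_from_to g x y \<longleftrightarrow> g ` {0..d x y} \<subseteq> M \<and> g 0 = x \<and> g (d x y) = y \<and>
      (\<forall>t\<in>{0..d x y}. \<forall>t'\<in>{0..d x y}. d (g t) (g t') = \<bar>t - t'\<bar>)"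

definition geodesic_space :: bool where
  "geodesic_space \<longleftrightarrow> (\<forall>x\<in>M. \<forall>y\<in>M. \<exists>g. geodesic_from_to g x y)"

definition on_geodesic :: "'a \<Rightarrow> 'a \<Rightarrow> 'a \<Rightarrow> bool" where
  "on_geodesic y z x \<longleftrightarrow> (\<exists>g. geodesic_from_to g z x \<and> y \<in> g ` {0..d z x})"

definition hyperbolic :: "real \<Rightarrow> bool" where
  "hyperbolic \<delta> \<longleftrightarrow> 0 \<le> \<delta> \<and> geodesic_space \<and>
      (\<forall>x\<in>M. \<forall>x'\<in>M. \<forall>z\<in>M. \<forall>y y'.
         on_geodesic y z x \<and> on_geodesic y' z x' \<and> d y z = d y' z \<and>
         d y z \<le> (d x z + d x' z - d x x') / 2 \<longrightarrow> d y y' \<le> \<delta>)"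

lemma multiplicity_at_le_iff:
  "multiplicity_at s I B \<le> enat n \<longleftrightarrow> (\<forall>A\<subseteq>M. ext_diam A \<le> ennreal s \<longrightarrow>
      finite {i\<in>I. A \<inter> B i \<noteq> {}} \<and> card {i\<in>I. A \<inter> B i \<noteq> {}} \<le> n)" (is "?L \<longleftrightarrow> ?P n")
proof
  assume "?P n"
  then show ?L unfolding multiplicity_at_def by (intro Inf_lower) auto
next
  assume L: ?L
  let ?S = "{enat n | n. ?P n}"
  have "?S \<noteq> {}"
  proof
    assume "?S = {}"
    then have "multiplicity_at s I B = \<infinity>"
      unfolding multiplicity_at_def by (simp only: Inf_enat_def if_True simp_thms)
    with L show False by simp
  qed
  then obtain e where "e \<in> ?S" by blast
  then have "Inf ?S \<in> ?S" by (rule wellorder_InfI)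
  then obtain m where m: "Inf ?S = enat m" "?P m" by auto
  with L have "m \<le> n" unfolding multiplicity_at_def by simp
  then show "?P n" using m(2) order_trans by blast
qed

lemma has_bounded_coveringI:
  fixes J :: "'j set" and C :: "'j \<Rightarrow> 'a set"
  assumes "covering J C" "bounded_family D J C"
    and "ereal_of_enat (multiplicity_at s J C) \<le> ereal (of_int k)"
  shows "has_bounded_covering D s k"
proof -
  obtain n where n: "multiplicity_at s J C = enat n"
    using assms(3) by (cases "multiplicity_at s J C") auto
  have mult: "finite {i\<in>J. A \<inter> C i \<noteq> {}} \<and> card {i\<in>J. A \<inter> C i \<noteq> {}} \<le> n"
    if "A \<subseteq> M" "ext_diam A \<le> ennreal s" for A
    using that n multiplicity_at_le_iff[of s J C n] by simp
  have "multiplicity_at s (C ` J) id \<le> enat n"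
    unfolding multiplicity_at_le_iff
  proof (intro allI impI)
    fix A assume A: "A \<subseteq> M" "ext_diam A \<le> ennreal s"
    have "{i \<in> C ` J. A \<inter> id i \<noteq> {}} = C ` {i\<in>J. A \<inter> C i \<noteq> {}}" by auto
    with mult[OF A] show "finite {i \<in> C ` J. A \<inter> id i \<noteq> {}} \<and>
        card {i \<in> C ` J. A \<inter> id i \<noteq> {}} \<le> n"
      using card_image_le[of "{i\<in>J. A \<inter> C i \<noteq> {}}" C] by (auto simp del: id_apply)
  qed
  then have "ereal_of_enat (multiplicity_at s (C ` J) id) \<le> ereal (of_int k)"
    using assms(3) unfolding n by (rule order_trans[OF iffD2[OF ereal_of_enat_le_iff]])
  moreover have "covering (C ` J) id" "bounded_family D (C ` J) id"
    using assms(1,2) by (auto simp: covering_def bounded_family_def)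
  ultimately show ?thesis unfolding has_bounded_covering_def by blast
qed

end

end

theory Submission
  imports Defs
begin

text \<open>
  Only scales \<open>s \<ge> \<delta>\<close> need an argument, and there the coverings of scale \<open>\<delta>\<close> can be transported
  to scale \<open>s\<close> by pushing points towards a base point \<open>z\<close>. Cut the space into the shells
  \<open>k s \<le> d z x < (k + 1) s\<close> and move every \<open>x\<close> of the \<open>k\<close>-th shell along a geodesic to the
  sphere of radius \<open>(k - 1) s\<close> around \<open>z\<close>, or to \<open>z\<close> itself if \<open>k = 0\<close>. This moves points by at
  most \<open>2 s\<close>, and two points of one shell at distance at most \<open>s\<close> have a Gromov product that is
  nonnegative and at least \<open>k s - s / 2\<close>, hence at least the new radius; hyperbolicity
  therefore brings their images within distance \<open>\<delta>\<close> of each other, however large \<open>s\<close> is.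
  Now pull back, in each shell separately, a \<open>c \<delta>\<close>-bounded covering whose
  \<open>\<delta>\<close>-multiplicity is at most \<open>n + 1\<close>. The members obtained have diameter at most
  \<open>4 s + c \<delta> \<le> (4 + c) s\<close>. A set of diameter at most \<open>s\<close> meets at most two shells, and the
  part of it in one shell is mapped to a set of diameter at most \<open>\<delta>\<close>, so it meets at most
  \<open>2 (n + 1)\<close> members. Hence the Nagata dimension is at most \<open>2 n + 1\<close>. The transport from scale
  \<open>\<delta>\<close> to scale \<open>s\<close> is the lemma \<open>has_bounded_covering_large_scale\<close>.
\<close>

context Metric_space
begin

lemma ext_diam_le_iff:
  assumes "0 \<le> D"
  shows "ext_diam A \<le> ennreal D \<longleftrightarrow> (\<forall>x\<in>A. \<forall>x'\<in>A. d x x' \<le> D)"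
  using assms by (auto simp: ext_diam_def SUP_le_iff)

lemma has_bounded_covering_empty:
  assumes "M = {}" "0 \<le> k"
  shows "has_bounded_covering D s k"
proof (rule has_bounded_coveringI[of "{}" "\<lambda>_. {}"])
  have "multiplicity_at s {} (\<lambda>_. {}) \<le> enat 0"
    unfolding multiplicity_at_le_iff by simp
  then have "multiplicity_at s {} (\<lambda>_. {}) = 0"
    by (simp flip: zero_enat_def)
  then show "ereal_of_enat (multiplicity_at s {} (\<lambda>_. {})) \<le> ereal (of_int k)"
    unfolding \<open>multiplicity_at s {} (\<lambda>_. {}) = 0\<close> using assms(2) by simp
qed (unfold covering_def bounded_family_def, use assms(1) in auto)

lemma has_bounded_covering_mono:
  assumes "has_bounded_covering D s k" "D \<le> D'" "k \<le> k'"
  shows "has_bounded_covering D' s k'"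
proof -
  obtain I and B :: "'a set \<Rightarrow> 'a set"
    where "covering I B" "bounded_family D I B"
      and "ereal_of_enat (multiplicity_at s I B) \<le> ereal (of_int k)"
    using assms(1) unfolding has_bounded_covering_def by blast
  moreover from this have "bounded_family D' I B"
    using ennreal_leI[OF assms(2)] order_trans unfolding bounded_family_def by blast
  moreover have "ereal (of_int k) \<le> ereal (of_int k')"
    using assms(3) by simp
  ultimately show ?thesis
    unfolding has_bounded_covering_def using order_trans by blast
qed

lemma has_bounded_coveringE:
  assumes "has_bounded_covering D s k"
  obtains I and B :: "'a set \<Rightarrow> 'a set"
  where "covering I B" "bounded_family D I B" "multiplicity_at s I B \<le> enat (nat k)" "0 \<le> k"
proof -
  obtain I and B :: "'a set \<Rightarrow> 'a set"
    where B: "covering I B" "bounded_family D I B"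
      and m: "ereal_of_enat (multiplicity_at s I B) \<le> ereal (of_int k)"
    using assms unfolding has_bounded_covering_def by blast
  obtain l where l: "multiplicity_at s I B = enat l" "real l \<le> of_int k"
    using m by (cases "multiplicity_at s I B") auto
  then have "int l \<le> k"
    by (metis of_int_le_iff of_int_of_nat_eq)
  then show thesis
    using that[OF B] l by auto
qed

lemma on_geodesic_at_radius:
  assumes "geodesic_space" "z \<in> M" "x \<in> M" "0 \<le> r" "r \<le> d z x"
  shows "\<exists>y\<in>M. on_geodesic y z x \<and> d z y = r \<and> d x y = d z x - r"
proof -
  obtain g where g: "geodesic_from_to g z x"
    using assms unfolding geodesic_space_def by blast
  have r: "r \<in> {0..d z x}" "0 \<in> {0..d z x}" "d z x \<in> {0..d z x}"
    using assms by auto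
  have dist: "d (g t) (g t') = \<bar>t - t'\<bar>" if "t \<in> {0..d z x}" "t' \<in> {0..d z x}" for t t'
    using g that unfolding geodesic_from_to_def by blast
  have "g r \<in> M" "g 0 = z" "g (d z x) = x"
    using g r unfolding geodesic_from_to_def by auto
  moreover have "on_geodesic (g r) z x"
    using g r unfolding on_geodesic_def by blast
  ultimately show ?thesis
    using dist[OF r(2) r(1)] dist[OF r(3) r(1)] r(1) by auto
qed

text \<open>
  This is where hyperbolicity enters. The bound \<open>\<delta>\<close> does not depend on \<open>s\<close>: receding by at
  least \<open>s / 2\<close> towards \<open>z\<close> keeps the radius at most the Gromov product of \<open>x\<close> and \<open>x'\<close>. The radius
  0 has to be allowed for the points that are too close to \<open>z\<close> to recede that far.
\<close>

lemma hyperbolic_recede_close: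
  assumes "hyperbolic \<delta>" "x \<in> M" "x' \<in> M" "z \<in> M"
    and "on_geodesic y z x" "on_geodesic y' z x'" "d z y = r" "d z y' = r"
    and "d x x' \<le> s"
    and "r = 0 \<or> r + s / 2 \<le> d z x \<and> r + s / 2 \<le> d z x'"
  shows "d y y' \<le> \<delta>"
proof -
  have "d x x' \<le> d x z + d x' z"
    using triangle[of x z x'] assms by (simp add: commute)
  then have "d y z \<le> (d x z + d x' z - d x x') / 2"
    using assms(7,9,10) by (auto simp: commute)
  moreover have "d y z = d y' z"
    using assms(7,8) by (simp add: commute)
  ultimately show ?thesis
    using assms unfolding hyperbolic_def by blast
qed

lemma has_bounded_covering_large_scale:
  assumes hyp: "hyperbolic \<delta>" and \<delta>: "0 < \<delta>" "\<delta> \<le> s" and D: "0 \<le> D"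
    and cov: "has_bounded_covering D \<delta> k"
  shows "has_bounded_covering (4 * s + D) s (2 * k)"
proof (cases "M = {}")
  case True
  have "0 \<le> k"
    using cov by (rule has_bounded_coveringE)
  then show ?thesis
    using True by (intro has_bounded_covering_empty) auto
next
  case False
  then obtain z where z: "z \<in> M" by blast
  have s: "0 < s" using \<delta> by simp
  obtain I and B :: "'a set \<Rightarrow> 'a set"
    where B: "covering I B" "bounded_family D I B"
      and mult: "multiplicity_at \<delta> I B \<le> enat (nat k)" and k: "0 \<le> k"
    using has_bounded_coveringE[OF cov] .
  define shell where "shell x = nat \<lfloor>d z x / s\<rfloor>" for x
  \<comment> \<open>The radius to which the \<open>j\<close>-th shell recedes; the shells 0 and 1 collapse to \<open>z\<close>.\<close>
  define r where "r j = max 0 ((real j - 1) * s)" for j :: nat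
  have shell: "real (shell x) * s \<le> d z x" "d z x < (real (shell x) + 1) * s" for x
  proof -
    have "real (shell x) = of_int \<lfloor>d z x / s\<rfloor>"
      using s by (simp add: shell_def)
    then have "real (shell x) \<le> d z x / s" "d z x / s < real (shell x) + 1"
      by linarith+
    then show "real (shell x) * s \<le> d z x" "d z x < (real (shell x) + 1) * s"
      using s by (simp_all add: field_simps)
  qed
  have r_nonneg: "0 \<le> r j" for j
    by (simp add: r_def)
  have r_le: "r (shell x) \<le> d z x" for x
    unfolding r_def using shell(1)[of x] s by (intro max.boundedI) (simp_all add: algebra_simps)
  have r_ge: "d z x \<le> r (shell x) + 2 * s" for x
  proof -
    have "(real (shell x) - 1) * s \<le> r (shell x)"
      by (simp add: r_def)
    then show ?thesis
      using shell(2)[of x] by (simp add: algebra_simps)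
  qed
  have "\<forall>x\<in>M. \<exists>y. y \<in> M \<and> on_geodesic y z x \<and> d z y = r (shell x) \<and> d x y = d z x - r (shell x)"
  proof
    fix x assume "x \<in> M"
    then show "\<exists>y. y \<in> M \<and> on_geodesic y z x \<and> d z y = r (shell x) \<and> d x y = d z x - r (shell x)"
      using on_geodesic_at_radius[OF _ z _ r_nonneg r_le[of x]] hyp
      unfolding hyperbolic_def by blast
  qed
  then obtain p where p: "p x \<in> M" "on_geodesic (p x) z x" "d z (p x) = r (shell x)"
      "d x (p x) = d z x - r (shell x)" if "x \<in> M" for x
    by metis
  have p_close: "d (p x) (p x') \<le> \<delta>"
    if "x \<in> M" "x' \<in> M" "shell x = shell x'" "d x x' \<le> s" for x x'
  proof (rule hyperbolic_recede_close[OF hyp that(1,2) z])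
    show "r (shell x) = 0 \<or> r (shell x) + s / 2 \<le> d z x \<and> r (shell x) + s / 2 \<le> d z x'"
      using shell(1)[of x] shell(1)[of x'] that(3) s by (auto simp: r_def max_def algebra_simps)
  qed (use p that in auto)
  define C where "C = (\<lambda>(j, i). {x \<in> M. shell x = j \<and> p x \<in> B i})"
  show ?thesis
  proof (rule has_bounded_coveringI[of "UNIV \<times> I" C])
    have "\<exists>i\<in>I. p x \<in> B i" if "x \<in> M" for x
      using B(1) p(1)[OF that] unfolding covering_def by blast
    then show "covering (UNIV \<times> I) C"
      by (auto simp: covering_def C_def)
  next
    have "d x x' \<le> 4 * s + D"
      if "i \<in> I" "x \<in> M" "x' \<in> M" "p x \<in> B i" "p x' \<in> B i" for i x x'
    proof -
      have "d (p x) (p x') \<le> D"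
        using B(2) that ext_diam_le_iff[OF D] unfolding bounded_family_def by blast
      moreover have "d x (p x) \<le> 2 * s" "d x' (p x') \<le> 2 * s"
        using p(4) r_ge[of x] r_ge[of x'] that by simp_all
      moreover have "d x x' \<le> d x (p x) + d (p x) (p x') + d x' (p x')"
        using triangle[of x "p x" x'] triangle[of "p x" "p x'" x'] p(1) that
        by (simp add: commute)
      ultimately show ?thesis by linarith
    qed
    then show "bounded_family (4 * s + D) (UNIV \<times> I) C"
      using s D by (auto simp: bounded_family_def C_def ext_diam_le_iff simp del: ennreal_plus)
  next
    have "multiplicity_at s (UNIV \<times> I) C \<le> enat (2 * nat k)"
      unfolding multiplicity_at_le_iff
    proof (intro allI impI)
      fix A assume A: "A \<subseteq> M" "ext_diam A \<le> ennreal s"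
      have dA: "d x x' \<le> s" if "x \<in> A" "x' \<in> A" for x x'
        using A(2) that s by (simp add: ext_diam_le_iff)
      define J where "J j = {i \<in> I. p ` {x \<in> A. shell x = j} \<inter> B i \<noteq> {}}" for j
      have J: "finite (J j) \<and> card (J j) \<le> nat k" for j
      proof -
        have "d (p x) (p x') \<le> \<delta>" if "x \<in> A" "x' \<in> A" "shell x = j" "shell x' = j" for x x'
          by (rule p_close) (use that A(1) dA in auto)
        then have "ext_diam (p ` {x \<in> A. shell x = j}) \<le> ennreal \<delta>"
          using \<delta>(1) by (simp add: ext_diam_le_iff)
        moreover have "p ` {x \<in> A. shell x = j} \<subseteq> M"
          using p(1) A(1) by blast
        ultimately show ?thesis
          using mult unfolding multiplicity_at_le_iff J_def by blast
      qed
      \<comment> \<open>The function \<open>d z\<close> varies by at most \<open>s\<close> on \<open>A\<close>, so only the innermost shell that \<open>A\<close> meets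
        and the next one occur; the half-open shells exclude a third.\<close>
      define m where "m = (LEAST j. j \<in> shell ` A)"
      have "shell x \<in> {m, Suc m}" if x: "x \<in> A" for x
      proof -
        have "m \<in> shell ` A"
          unfolding m_def by (rule LeastI[of _ "shell x"]) (use x in blast)
        then obtain a where a: "a \<in> A" "shell a = m" by blast
        have "m \<le> shell x"
          unfolding m_def using x by (intro Least_le) blast
        have "d z x \<le> d z a + s"
          using triangle[of z a x] dA[OF a(1) x] z subsetD[OF A(1) a(1)] subsetD[OF A(1) x] by simp
        then have "real (shell x) * s < (real m + 2) * s"
          using shell(1)[of x] shell(2)[of a] a(2) by (simp add: algebra_simps)
        then have "shell x < m + 2"
          using s by (simp add: mult_less_cancel_right)
        with \<open>m \<le> shell x\<close> show ?thesis by auto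
      qed
      then have shells: "shell ` A \<subseteq> {m, Suc m}" by blast
      have sub: "{ji \<in> UNIV \<times> I. A \<inter> C ji \<noteq> {}} \<subseteq> {m} \<times> J m \<union> {Suc m} \<times> J (Suc m)"
      proof
        fix ji assume ji: "ji \<in> {ji \<in> UNIV \<times> I. A \<inter> C ji \<noteq> {}}"
        obtain j i where [simp]: "ji = (j, i)" by fastforce
        have "i \<in> I" using ji by simp
        obtain x where "x \<in> A" "shell x = j" "p x \<in> B i"
          using ji by (auto simp: C_def)
        then have "i \<in> J j" "j \<in> {m, Suc m}"
          using \<open>i \<in> I\<close> shells unfolding J_def by blast+
        then show "ji \<in> {m} \<times> J m \<union> {Suc m} \<times> J (Suc m)"
          by auto
      qed
      have fin: "finite ({m} \<times> J m \<union> {Suc m} \<times> J (Suc m))"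
        using J by blast
      have "card ({m} \<times> J m \<union> {Suc m} \<times> J (Suc m)) \<le> card (J m) + card (J (Suc m))"
        using card_Un_le[of "{m} \<times> J m" "{Suc m} \<times> J (Suc m)"] by (simp add: card_cartesian_product)
      also have "\<dots> \<le> 2 * nat k"
        using J[of m] J[of "Suc m"] by linarith
      finally show "finite {ji \<in> UNIV \<times> I. A \<inter> C ji \<noteq> {}} \<and>
          card {ji \<in> UNIV \<times> I. A \<inter> C ji \<noteq> {}} \<le> 2 * nat k"
        using finite_subset[OF sub fin] card_mono[OF fin sub] by linarith
    qed
    then have "ereal_of_enat (multiplicity_at s (UNIV \<times> I) C) \<le> ereal_of_enat (enat (2 * nat k))"
      by (rule iffD2[OF ereal_of_enat_le_iff])
    then show "ereal_of_enat (multiplicity_at s (UNIV \<times> I) C) \<le> ereal (of_int (2 * k))"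
      using k by simp
  qed
qed

lemma nagata_dim_le:
  assumes "0 < c" "\<And>s. 0 < s \<Longrightarrow> has_bounded_covering (c * s) s (n + 1)"
  shows "nagata_dim \<le> ereal (of_int n)"
  unfolding nagata_dim_def using assms by (intro Inf_lower) blast

end

theorem proposition3p5:
  fixes M :: "'a set" and d :: "'a \<Rightarrow> 'a \<Rightarrow> real" and \<delta> c :: real and n :: int
  assumes "Metric_space M d"
    and "\<delta> > 0"
    and "Metric_space.hyperbolic M d \<delta>"
    and "n \<ge> 0" and "c > 0"
    and "\<forall>s. 0 < s \<and> s \<le> \<delta> \<longrightarrow> Metric_space.has_bounded_covering M d (c * s) s (n + 1)"
  shows "Metric_space.nagata_dim M d < \<infinity>"
proof -
  interpret Metric_space M d by (rule assms(1))
  have "has_bounded_covering ((4 + c) * s) s ((2 * n + 1) + 1)" if s: "0 < s" for s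
  proof (cases "s \<le> \<delta>")
    case True
    then have "has_bounded_covering (c * s) s (n + 1)"
      using assms(6) s by blast
    then show ?thesis
      by (rule has_bounded_covering_mono) (use s assms(4) in \<open>auto simp: algebra_simps\<close>)
  next
    case False
    have "has_bounded_covering (c * \<delta>) \<delta> (n + 1)"
      using assms(2,6) by blast
    then have "has_bounded_covering (4 * s + c * \<delta>) s (2 * (n + 1))"
      by (rule has_bounded_covering_large_scale[OF assms(3,2), rotated 2])
        (use False assms(2,5) in auto)
    then show ?thesis
      by (rule has_bounded_covering_mono)
        (use False assms(5) in \<open>auto simp: algebra_simps intro: mult_left_mono\<close>)
  qed
  then have "nagata_dim \<le> ereal (of_int (2 * n + 1))"
    using assms(5) by (intro nagata_dim_le[of "4 + c"]) auto
  then show ?thesis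
    by (rule order.strict_trans1) simp
qed

end
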